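(* $\mathfrak{sp}'\leq\mathfrak{u}$.
   Context: A compactification $\alpha\omega$ of the countable discrete space $\omega$ is a compact Hausdorff space containing $\omega$ as a dense subspace. $\alpha\omega\leq\gamma\omega$ means there is a continuous surjection $f:\gamma\omega\to\alpha\omega$ whose restriction to $\omega$ is the identity; $\alpha\omega\simeq\gamma\omega$ means such an $f$ can be chosen to be a homeomorphism. Modulo $\simeq$, compactifications of $\omega$ ordered by $\leq$ form a complete upper semilattice with largest element the Stone–Čech compactification $\beta\omega$; $\sup$ is taken in it. $C_{\alpha\omega}$ denotes the set of bounded functions $\omega\to\mathbb{R}$ that extend continuously over $\alpha\omega$; it determines $\alpha\omega$ up to $\simeq$, and every subring of the ring of bounded functions on $\omega$ that is closed in the uniform norm, contains all constants and generates the topology of $\omega$ is of this form. $\mathrm{M}(\omega)$ is the set of all metrics on $\omega$ compatible with the discrete topology. For $d\in\mathrm{M}(\omega)$, the Smirnov compactification $u_d\omega$ is the compactification with $C_{u_d\omega}=U^*_d(\omega)$, the ring of all bounded uniformly continuous functions from $(\omega,d)$ to $\mathbb{R}$. $\mathrm{M}'(\omega)$ is the set of $d\in\mathrm{M}(\omega)$ with $\beta\omega\not\simeq u_d\omega$. For $d_1,d_2\in\mathrm{M}(\omega)$, $d_1\preceq d_2$ means $U^*_{d_1}(\omega)\subseteq U^*_{d_2}(\omega)$ (equivalently $u_{d_1}\omega\leq u_{d_2}\omega$). $\mathfrak{sp}'$ is the smallest cardinality of a set $D\subseteq\mathrm{M}'(\omega)$ that is directed with respect to $\preceq$ (for any $d_1,d_2\in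 D$ there is $d\in D$ with $d_1\preceq d$ and $d_2\preceq d$) and satisfies $\beta\omega\simeq\sup\{u_d\omega: d\in D\}$. An ultrafilter means a non-principal ultrafilter on $\omega$. A family $\mathcal{F}\subseteq\mathcal{U}$ generates the ultrafilter $\mathcal{U}$ if every $X\in\mathcal{U}$ has a subset $Y\in\mathcal{F}$. $\mathfrak{u}$ is the smallest cardinality of a subset of $\mathcal{P}(\omega)$ which generates an ultrafilter. Convention: if no set of the required kind exists, the cardinal being defined is $\infty$, and $\lambda<\infty$ for every cardinal $\lambda$. *)

theory Defs
  imports "HOL-Analysis.Analysis"
begin

unbundle cardinal_syntax

text \<open>
  The space \<open>\<omega>\<close> is the type \<^typ>\<open>nat\<close>. A compactification is a compact Hausdorff space together with
  a dense embedding of the discrete space \<^typ>\<open>nat\<close>; a map is the identity on \<open>\<omega>\<close> when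
  it commutes with the embeddings.
\<close>

type_synonym 'a cpt = "'a topology \<times> (nat \<Rightarrow> 'a)"

definition compactification :: "'a cpt \<Rightarrow> bool" where
  "compactification K \<longleftrightarrow>
     compact_space (fst K) \<and> Hausdorff_space (fst K) \<and>
     embedding_map (discrete_topology UNIV) (fst K) (snd K) \<and>
     fst K closure_of range (snd K) = topspace (fst K)"

definition cpt_le :: "'a cpt \<Rightarrow> 'b cpt \<Rightarrow> bool" where
  "cpt_le K L \<longleftrightarrow>
     (\<exists>h. continuous_map (fst L) (fst K) h \<and> h ` topspace (fst L) = topspace (fst K) \<and>
          (\<forall>n. h (snd L n) = snd K n))"

definition cpt_equiv :: "'a cpt \<Rightarrow> 'b cpt \<Rightarrow> bool" where
  "cpt_equiv K L \<longleftrightarrow>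
     (\<exists>h. homeomorphic_map (fst L) (fst K) h \<and> (\<forall>n. h (snd L n) = snd K n))"

definition bounded_funs :: "(nat \<Rightarrow> real) set" where
  "bounded_funs = {f. bounded (range f)}"

definition ext_ring :: "'a cpt \<Rightarrow> (nat \<Rightarrow> real) set" where
  "ext_ring K =
     {f \<in> bounded_funs. \<exists>g. continuous_map (fst K) euclideanreal g \<and> (\<forall>n. g (snd K n) = f n)}"

text \<open>
  The compactification obtained from the evaluation map into the cube indexed by \<open>A\<close>. The
  coordinates outside \<open>A\<close> are constantly \<open>0\<close>, so that all these spaces live in one type.
  By \<open>cpt_equiv_eval_cpt\<close> below, every compactification, on whatever type, is equivalent to one
  of these; hence nothing is lost when a quantifier ranges over \<open>cube cpt\<close> only.
\<close>

type_synonym cube = "(nat \<Rightarrow> real) \<Rightarrow> real"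

definition eval_map :: "(nat \<Rightarrow> real) set \<Rightarrow> nat \<Rightarrow> cube" where
  "eval_map A n = (\<lambda>f. if f \<in> A then f n else 0)"

definition eval_cpt :: "(nat \<Rightarrow> real) set \<Rightarrow> cube cpt" where
  "eval_cpt A = (top_of_set (closure (range (eval_map A))), eval_map A)"

definition stone_cech :: "cube cpt" where
  "stone_cech = eval_cpt bounded_funs"

text \<open>
  \<open>K\<close> represents the supremum of \<open>S\<close> in the semilattice of compactifications modulo
  \<^const>\<open>cpt_equiv\<close>.
\<close>

definition is_cpt_sup :: "cube cpt \<Rightarrow> cube cpt set \<Rightarrow> bool" where
  "is_cpt_sup K S \<longleftrightarrow>
     compactification K \<and> (\<forall>L\<in>S. cpt_le L K) \<and>
     (\<forall>M :: cube cpt. compactification M \<longrightarrow> (\<forall>L\<in>S. cpt_le L M) \<longrightarrow> cpt_le K M)"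

definition metrics :: "(nat \<Rightarrow> nat \<Rightarrow> real) set" where
  "metrics = {d. Metric_space UNIV d \<and> Metric_space.mtopology UNIV d = discrete_topology UNIV}"

definition U_star :: "(nat \<Rightarrow> nat \<Rightarrow> real) \<Rightarrow> (nat \<Rightarrow> real) set" where
  "U_star d =
     {f \<in> bounded_funs. uniformly_continuous_map (metric (UNIV, d)) euclidean_metric f}"

text \<open>
  The choice exists (lemma \<open>smirnov\<close> below) and is unique up to \<^const>\<open>cpt_equiv\<close>.
\<close>

definition smirnov :: "(nat \<Rightarrow> nat \<Rightarrow> real) \<Rightarrow> cube cpt" where
  "smirnov d = (SOME K. compactification K \<and> ext_ring K = U_star d)"

definition metrics' :: "(nat \<Rightarrow> nat \<Rightarrow> real) set" where
  "metrics' = {d \<in> metrics. \<not> cpt_equiv stone_cech (smirnov d)}"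

definition metric_le :: "(nat \<Rightarrow> nat \<Rightarrow> real) \<Rightarrow> (nat \<Rightarrow> nat \<Rightarrow> real) \<Rightarrow> bool" where
  "metric_le d1 d2 \<longleftrightarrow> U_star d1 \<subseteq> U_star d2"

definition metric_directed :: "(nat \<Rightarrow> nat \<Rightarrow> real) set \<Rightarrow> bool" where
  "metric_directed D \<longleftrightarrow> (\<forall>d1\<in>D. \<forall>d2\<in>D. \<exists>d\<in>D. metric_le d1 d \<and> metric_le d2 d)"

definition nonprincipal_ultrafilter :: "nat set set \<Rightarrow> bool" where
  "nonprincipal_ultrafilter U \<longleftrightarrow>
     {} \<notin> U \<and> (\<forall>X\<in>U. \<forall>Y\<in>U. X \<inter> Y \<in> U) \<and> (\<forall>X\<in>U. \<forall>Y. X \<subseteq> Y \<longrightarrow> Y \<in> U) \<and>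
     (\<forall>X. X \<in> U \<or> - X \<in> U) \<and> (\<forall>n. {n} \<notin> U)"

definition generates_ultrafilter :: "nat set set \<Rightarrow> nat set set \<Rightarrow> bool" where
  "generates_ultrafilter F U \<longleftrightarrow> F \<subseteq> U \<and> (\<forall>X\<in>U. \<exists>Y\<in>F. Y \<subseteq> X)"

text \<open>
  A cardinal is represented by a cardinal order relation, and \<open>\<infinity>\<close> by \<^const>\<open>None\<close>.
\<close>

definition min_card :: "('a set \<Rightarrow> bool) \<Rightarrow> 'a rel option" where
  "min_card P =
     (if \<exists>A. P A then Some |SOME A. P A \<and> (\<forall>B. P B \<longrightarrow> |A| \<le>o |B| )| else None)"

definition card_inf_le :: "'a rel option \<Rightarrow> 'b rel option \<Rightarrow> bool" where
  "card_inf_le k l =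
     (case l of None \<Rightarrow> True | Some s \<Rightarrow> (case k of None \<Rightarrow> False | Some r \<Rightarrow> r \<le>o s))"

definition sp' :: "(nat \<Rightarrow> nat \<Rightarrow> real) rel option" where
  "sp' = min_card (\<lambda>D. D \<subseteq> metrics' \<and> metric_directed D \<and> is_cpt_sup stone_cech (smirnov ` D))"

definition ultrafilter_number :: "nat set rel option" where
  "ultrafilter_number =
     min_card (\<lambda>F. \<exists>U. nonprincipal_ultrafilter U \<and> generates_ultrafilter F U)"

lemma min_card_SomeE:
  assumes "min_card P = Some r"
  obtains A where "P A" "r = |A|" "\<And>B. P B \<Longrightarrow> |A| \<le>o |B|"
proof -
  have ex: "\<exists>A. P A"
    using assms by (auto simp: min_card_def split: if_splits)
  have "\<exists>r\<in>card_of ` {A. P A}. \<forall>r'\<in>card_of ` {A. P A}. r \<le>o r'"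
    by (rule exists_minim_Card_order) (use ex in \<open>auto simp: card_of_Card_order\<close>)
  then have "\<exists>A. P A \<and> (\<forall>B. P B \<longrightarrow> |A| \<le>o |B| )"
    by blast
  from someI_ex[OF this] show ?thesis
    using assms ex that by (auto simp: min_card_def)
qed

lemma compactification_in_topspace:
  assumes "compactification K"
  shows "snd K n \<in> topspace (fst K)"
proof -
  have "snd K ` UNIV \<subseteq> fst K closure_of range (snd K)"
  proof (rule closure_of_subset)
    have "embedding_map (discrete_topology UNIV) (fst K) (snd K)"
      using assms by (simp add: compactification_def)
    then have "continuous_map (discrete_topology UNIV) (fst K) (snd K)"
      unfolding embedding_map_def
      by (meson continuous_map_into_fulltopology homeomorphic_imp_continuous_map)
    then show "range (snd K) \<subseteq> topspace (fst K)"
      using continuous_map_image_subset_topspace[of "discrete_topology UNIV" "fst K" "snd K"] by simp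
  qed
  then show ?thesis
    using closure_of_subset_topspace by (meson rangeI subsetD)
qed

lemma Hausdorff_space_cube: "Hausdorff_space (euclidean :: cube topology)"
  by (metis Hausdorff_space_euclidean Hausdorff_space_product_topology euclidean_product_topology)

lemma closed_compact_cube: "compact (S :: cube set) \<Longrightarrow> closed S"
  using compactin_imp_closedin[OF Hausdorff_space_cube, of S] by simp

lemma continuous_map_eval_map:
  assumes "\<And>f. f \<in> A \<Longrightarrow> continuous_map X euclideanreal (g f)"
  shows "continuous_map X euclidean (\<lambda>x f. if f \<in> A then g f x else 0)"
proof -
  have "continuous_map X (product_topology (\<lambda>i. euclideanreal) UNIV) (\<lambda>x f. if f \<in> A then g f x else 0)"
    unfolding continuous_map_componentwise_UNIV using assms by auto
  then show ?thesis
    by (simp add: euclidean_product_topology)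
qed

lemma compact_closure_eval_map:
  assumes "A \<subseteq> bounded_funs"
  shows "compact (closure (range (eval_map A)))"
proof -
  have "\<exists>b. \<forall>n. \<bar>eval_map A n f\<bar> \<le> b" for f
    using assms by (cases "f \<in> A") (auto simp: eval_map_def bounded_funs_def bounded_iff)
  then obtain b where b: "\<And>f n. \<bar>eval_map A n f\<bar> \<le> b f"
    by metis
  let ?C = "PiE UNIV (\<lambda>f. {- b f..b f})"
  have "compactin (product_topology (\<lambda>i. euclideanreal) UNIV) ?C"
    by (simp add: compactin_PiE)
  then have "compact ?C"
    by (simp add: euclidean_product_topology)
  moreover have "range (eval_map A) \<subseteq> ?C"
    using b by (auto simp: abs_le_iff minus_le_iff)
  ultimately have "closure (range (eval_map A)) \<subseteq> ?C"
    by (intro closure_minimal closed_compact_cube)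
  then have "closure (range (eval_map A)) = ?C \<inter> closure (range (eval_map A))"
    by (rule inf.absorb2[symmetric])
  with \<open>compact ?C\<close> show ?thesis
    using compact_Int_closed closed_closure by metis
qed

lemma compactification_eval_cpt:
  assumes A: "A \<subseteq> bounded_funs"
    and sep: "\<And>n. \<exists>f\<in>A. \<exists>e>0. \<forall>m. m \<noteq> n \<longrightarrow> \<bar>f m - f n\<bar> \<ge> e"
  shows "compactification (eval_cpt A)"
proof -
  let ?S = "closure (range (eval_map A))"
  have sub: "range (eval_map A) \<subseteq> ?S"
    by (rule closure_subset)
  have op: "openin (top_of_set ?S) {eval_map A n}" and ne: "m \<noteq> n \<Longrightarrow> eval_map A m \<noteq> eval_map A n" for m n
  proof -
    obtain f e where f: "f \<in> A" "e > 0" "\<And>m. m \<noteq> n \<Longrightarrow> \<bar>f m - f n\<bar> \<ge> e"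
      using sep by blast
    let ?U = "(\<lambda>x :: cube. x f) -` ball (f n) e"
    have U: "open ?U"
      by (intro open_vimage) auto
    have "?U \<inter> range (eval_map A) \<subseteq> {eval_map A n}"
      using f by (fastforce simp: eval_map_def dist_real_def abs_minus_commute)
    then have "?U \<inter> ?S \<subseteq> closure {eval_map A n}"
      by (intro order_trans[OF open_Int_closure_subset[OF U]] closure_mono)
    moreover have "closure {eval_map A n} = {eval_map A n}"
      by (simp add: closed_compact_cube closure_closed)
    ultimately have "?S \<inter> ?U = {eval_map A n}"
      using f sub by (auto simp: eval_map_def)
    with U show "openin (top_of_set ?S) {eval_map A n}"
      by (metis openin_open)
    assume "m \<noteq> n"
    have "eval_map A m f \<noteq> eval_map A n f"
      using f(3)[OF \<open>m \<noteq> n\<close>] f(1,2) by (auto simp: eval_map_def)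
    then show "eval_map A m \<noteq> eval_map A n"
      by auto
  qed
  have "open_map (discrete_topology UNIV) (top_of_set ?S) (eval_map A)"
    unfolding open_map_def
  proof safe
    fix W :: "nat set"
    have "openin (top_of_set ?S) (\<Union>n\<in>W. {eval_map A n})"
      using op by blast
    then show "openin (top_of_set ?S) (eval_map A ` W)"
      by (simp add: UNION_singleton_eq_range)
  qed
  moreover have "inj (eval_map A)"
    using ne by (meson injI)
  ultimately have "embedding_map (discrete_topology UNIV) (top_of_set ?S) (eval_map A)"
    using sub by (intro injective_open_imp_embedding_map) (auto simp: Pi_iff)
  then show ?thesis
    using compact_closure_eval_map[OF A] sub
    by (auto simp: compactification_def eval_cpt_def compact_space_subtopology
        Hausdorff_space_subtopology Hausdorff_space_cube closure_of_subtopology Int_absorb1)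
qed

lemma ext_ring_eval_cpt_superset:
  assumes "A \<subseteq> bounded_funs"
  shows "A \<subseteq> ext_ring (eval_cpt A)"
proof
  fix f assume f: "f \<in> A"
  have "continuous_map (fst (eval_cpt A)) euclideanreal (\<lambda>x. x f)"
    by (auto simp: eval_cpt_def intro: continuous_on_subset[OF continuous_on_product_coordinates])
  moreover have "\<forall>n. snd (eval_cpt A) n f = f n"
    using f by (simp add: eval_cpt_def eval_map_def)
  ultimately show "f \<in> ext_ring (eval_cpt A)"
    using f assms unfolding ext_ring_def by blast
qed

lemma cpt_equiv_eval_cpt:
  fixes K :: "'a cpt"
  assumes K: "compactification K"
  shows "cpt_equiv (eval_cpt (ext_ring K)) K"
proof -
  let ?A = "ext_ring K"
  let ?X = "fst K"
  let ?S = "closure (range (eval_map ?A))"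
  have "\<forall>f\<in>?A. \<exists>g. continuous_map ?X euclideanreal g \<and> (\<forall>n. g (snd K n) = f n)"
    by (simp add: ext_ring_def)
  then obtain g where g: "\<And>f. f \<in> ?A \<Longrightarrow> continuous_map ?X euclideanreal (g f)"
    "\<And>f n. f \<in> ?A \<Longrightarrow> g f (snd K n) = f n"
    by metis
  define h where "h = (\<lambda>x f. if f \<in> ?A then g f x else 0)"
  have com: "compact_space ?X" and Hau: "Hausdorff_space ?X"
    and emb: "embedding_map (discrete_topology UNIV) ?X (snd K)"
    and dense: "?X closure_of range (snd K) = topspace ?X"
    using K by (auto simp: compactification_def)
  have in_X: "snd K n \<in> topspace ?X" for n
    using K by (rule compactification_in_topspace)
  have hK: "h (snd K n) = eval_map ?A n" for n
    using g(2) by (auto simp: h_def eval_map_def)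
  have h: "continuous_map ?X euclidean h"
    unfolding h_def using g(1) by (rule continuous_map_eval_map)
  have "h ` topspace ?X \<subseteq> ?S"
  proof -
    have "h ` (?X closure_of range (snd K)) \<subseteq> euclidean closure_of (h ` range (snd K))"
      using h by (rule continuous_map_image_closure_subset)
    then show ?thesis
      by (simp add: dense image_image hK)
  qed
  moreover have "?S \<subseteq> h ` topspace ?X"
  proof (rule closure_minimal)
    show "range (eval_map ?A) \<subseteq> h ` topspace ?X"
      using in_X hK by (metis image_eqI image_subsetI)
    have "compactin euclidean (h ` topspace ?X)"
      using com h by (metis compact_space_def image_compactin)
    then show "closed (h ` topspace ?X)"
      by (simp add: closed_compact_cube)
  qed
  ultimately have im: "h ` topspace ?X = ?S"
    by blast
  have "inj_on h (topspace ?X)"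
  proof (rule inj_onI, rule ccontr)
    fix x y assume xy: "x \<in> topspace ?X" "y \<in> topspace ?X" "h x = h y" "x \<noteq> y"
    have "normal_space ?X"
      using com Hau compact_Hausdorff_or_regular_imp_normal_space by blast
    moreover have "closedin ?X {x}" "closedin ?X {y}"
      using Hau xy by (auto simp: closedin_Hausdorff_singleton)
    ultimately obtain u :: "'a \<Rightarrow> real" where
      u: "continuous_map ?X euclideanreal u" "u ` {x} \<subseteq> {0}" "u ` {y} \<subseteq> {1}"
      using Urysohn_lemma_alt[of ?X "{x}" "{y}" 0 1] xy(4) by (auto simp: disjnt_def)
    let ?f = "\<lambda>n. u (snd K n)"
    have "compactin euclidean (u ` topspace ?X)"
      using com u(1) by (metis compact_space_def image_compactin)
    then have "bounded (u ` topspace ?X)"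
      by (simp add: compact_imp_bounded)
    then have "bounded (range ?f)"
      by (rule bounded_subset) (use in_X in auto)
    with u(1) have f: "?f \<in> ?A"
      by (auto simp: ext_ring_def bounded_funs_def)
    have "g ?f z = u z" if "z \<in> topspace ?X" for z
      by (rule forall_in_closure_of_eq[where X = ?X and S = "range (snd K)" and Y = euclideanreal])
         (use that dense g f u in \<open>auto\<close>)
    then have "h x ?f = u x" "h y ?f = u y"
      using f xy(1,2) by (simp_all add: h_def)
    with xy(3) u show False by auto
  qed
  moreover have "continuous_map ?X (top_of_set ?S) h"
    using h im by (auto simp: continuous_map_in_subtopology)
  ultimately have "homeomorphic_map ?X (top_of_set ?S) h"
    using com im by (intro continuous_imp_homeomorphic_map) (auto simp: Hausdorff_space_subtopology Hausdorff_space_cube)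
  with hK show ?thesis
    unfolding cpt_equiv_def eval_cpt_def by auto
qed

lemma cpt_le_eval_cpt_mono:
  assumes "A \<subseteq> B" "B \<subseteq> bounded_funs"
  shows "cpt_le (eval_cpt A) (eval_cpt B)"
proof -
  define h where "h = (\<lambda>(x :: cube) f. if f \<in> A then x f else 0)"
  let ?S = "closure (range (eval_map A))"
  let ?T = "closure (range (eval_map B))"
  have hB: "h (eval_map B n) = eval_map A n" for n
    using assms(1) by (auto simp: h_def eval_map_def fun_eq_iff)
  have h: "continuous_on UNIV h"
    using continuous_map_eval_map[of A euclidean "\<lambda>f x. x f"] by (simp add: h_def)
  have "h ` ?T \<subseteq> ?S"
  proof -
    have "h ` ?T \<subseteq> closure (h ` range (eval_map B))"
      by (rule image_closure_subset[OF continuous_on_subset[OF h]]) (auto intro: closure_subset[THEN subsetD])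
    then show ?thesis
      by (simp add: image_image hB)
  qed
  moreover have "?S \<subseteq> h ` ?T"
  proof (rule closure_minimal)
    show "range (eval_map A) \<subseteq> h ` ?T"
      using closure_subset[of "range (eval_map B)"] hB by (metis image_eqI image_subsetI rangeI subsetD)
    show "closed (h ` ?T)"
      by (intro closed_compact_cube compact_continuous_image continuous_on_subset[OF h]
          compact_closure_eval_map assms(2)) auto
  qed
  ultimately have "h ` ?T = ?S"
    by blast
  then show ?thesis
    using hB h unfolding cpt_le_def eval_cpt_def
    by (intro exI[of _ h]) (auto intro: continuous_on_subset)
qed

lemma compactification_stone_cech: "compactification stone_cech"
  unfolding stone_cech_def
proof (rule compactification_eval_cpt)
  fix n :: nat
  have "bounded (range (\<lambda>m. if m = n then 1 else 0 :: real))"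
    by (rule bounded_subset[of "{0, 1}"]) auto
  then show "\<exists>f\<in>bounded_funs. \<exists>e>0. \<forall>m. m \<noteq> n \<longrightarrow> \<bar>f m - f n\<bar> \<ge> e"
    by (intro bexI[of _ "\<lambda>m. if m = n then 1 else 0"] exI[of _ 1]) (auto simp: bounded_funs_def)
qed simp

lemma stone_cech_largest:
  fixes K :: "'a cpt"
  assumes "compactification K"
  shows "cpt_le K stone_cech"
proof -
  obtain h where h: "homeomorphic_map (fst K) (fst (eval_cpt (ext_ring K))) h"
    "\<And>n. h (snd K n) = snd (eval_cpt (ext_ring K)) n"
    using cpt_equiv_eval_cpt[OF assms] unfolding cpt_equiv_def by blast
  then obtain k where k: "homeomorphic_maps (fst K) (fst (eval_cpt (ext_ring K))) h k"
    using homeomorphic_map_maps by blast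
  obtain p where p: "continuous_map (fst stone_cech) (fst (eval_cpt (ext_ring K))) p"
    "p ` topspace (fst stone_cech) = topspace (fst (eval_cpt (ext_ring K)))"
    "\<And>n. p (snd stone_cech n) = snd (eval_cpt (ext_ring K)) n"
    using cpt_le_eval_cpt_mono[of "ext_ring K" bounded_funs]
    unfolding cpt_le_def stone_cech_def ext_ring_def by blast
  have K: "snd K n \<in> topspace (fst K)" for n
    using assms by (rule compactification_in_topspace)
  have "continuous_map (fst stone_cech) (fst K) (k \<circ> p)"
    using k p(1) by (auto simp: homeomorphic_maps_def intro: continuous_map_compose)
  moreover have "(k \<circ> p) ` topspace (fst stone_cech) = topspace (fst K)"
    using k p(2) by (metis homeomorphic_imp_surjective_map homeomorphic_maps_map image_comp)
  moreover have "(k \<circ> p) (snd stone_cech n) = snd K n" for n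
    using k p(3) h(2) K by (metis comp_apply homeomorphic_maps_def)
  ultimately show ?thesis
    unfolding cpt_le_def by blast
qed

lemma mem_U_star_iff:
  assumes "d \<in> metrics"
  shows "f \<in> U_star d \<longleftrightarrow>
    f \<in> bounded_funs \<and> (\<forall>e>0. \<exists>r>0. \<forall>x y. d x y < r \<longrightarrow> \<bar>f x - f y\<bar> < e)"
proof -
  interpret Metric_space UNIV d
    using assms by (simp add: metrics_def)
  show ?thesis
    unfolding U_star_def uniformly_continuous_map_def
    by (auto simp: dist_real_def) (metis commute)+
qed

lemma smirnov_exists:
  assumes "d \<in> metrics"
  shows "compactification (eval_cpt (U_star d)) \<and> ext_ring (eval_cpt (U_star d)) = U_star d"
proof
  interpret Metric_space UNIV d
    using assms by (simp add: metrics_def)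
  note U = mem_U_star_iff[OF assms]
  have sub: "U_star d \<subseteq> bounded_funs"
    by (auto simp: U_star_def)
  show "compactification (eval_cpt (U_star d))"
  proof (rule compactification_eval_cpt[OF sub])
    fix n
    have "openin mtopology {n}"
      using assms by (simp add: metrics_def)
    then obtain r where r: "r > 0" "mball n r \<subseteq> {n}"
      unfolding openin_mtopology by blast
    let ?f = "\<lambda>m. min 1 (d n m)"
    have "\<bar>?f x - ?f y\<bar> \<le> d x y" for x y
      using triangle[of n x y] triangle[of n y x] commute[of x y] nonneg[of x y] by (auto simp: min_def)
    then have "\<forall>e>0. \<exists>r>0. \<forall>x y. d x y < r \<longrightarrow> \<bar>?f x - ?f y\<bar> < e"
      by (meson le_less_trans)
    moreover have "bounded (range ?f)"
      by (rule bounded_subset[of "{0..1}"]) auto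
    ultimately have "?f \<in> U_star d"
      by (simp add: U bounded_funs_def)
    moreover have "\<bar>?f m - ?f n\<bar> \<ge> min 1 r" if "m \<noteq> n" for m
    proof -
      have "m \<notin> mball n r"
        using r that by blast
      then show ?thesis
        by auto
    qed
    ultimately show "\<exists>f\<in>U_star d. \<exists>e>0. \<forall>m. m \<noteq> n \<longrightarrow> \<bar>f m - f n\<bar> \<ge> e"
      using r by (intro bexI[of _ ?f] exI[of _ "min 1 r"]) auto
  qed
  let ?e = "eval_map (U_star d)"
  let ?S = "closure (range ?e)"
  have "ext_ring (eval_cpt (U_star d)) \<subseteq> U_star d"
  proof
    fix f assume "f \<in> ext_ring (eval_cpt (U_star d))"
    then obtain g where f: "f \<in> bounded_funs" and g: "continuous_on ?S g" "\<And>n. g (?e n) = f n"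
      by (auto simp: ext_ring_def eval_cpt_def)
    have "\<exists>r>0. \<forall>x y. d x y < r \<longrightarrow> \<bar>f x - f y\<bar> < e" if e: "e > 0" for e
    proof (rule ccontr)
      assume no: "\<not> ?thesis"
      define P where "P r = {(?e x, ?e y) |x y. d x y < r \<and> \<bar>f x - f y\<bar> \<ge> e}" for r
      have cS: "compact (?S \<times> ?S)"
        by (intro compact_Times compact_closure_eval_map sub)
      have "(?S \<times> ?S) \<inter> (\<Inter>r\<in>{0<..}. closure (P r)) \<noteq> {}"
      proof (rule compact_imp_fip_image[OF cS])
        fix I :: "real set" assume I: "finite I" "I \<subseteq> {0<..}"
        obtain r where r: "r > 0" "\<And>s. s \<in> I \<Longrightarrow> r \<le> s"
        proof (cases "I = {}")
          case False
          then show ?thesis using I that[of "Min I"] by (auto simp: Min_gr_iff)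
        qed (use that[of 1] in auto)
        obtain x y where xy: "d x y < r" "\<bar>f x - f y\<bar> \<ge> e"
          using no r(1) by (meson not_less)
        have "(?e x, ?e y) \<in> P s" if "s \<in> I" for s
          using xy r(2)[OF that] by (fastforce simp: P_def)
        then have "(?e x, ?e y) \<in> (?S \<times> ?S) \<inter> (\<Inter>r\<in>I. closure (P r))"
          using closure_subset[of "range ?e"] by (auto intro!: closure_subset[THEN subsetD])
        then show "(?S \<times> ?S) \<inter> (\<Inter>r\<in>I. closure (P r)) \<noteq> {}"
          by blast
      qed auto
      then obtain p q where pq: "p \<in> ?S" "q \<in> ?S" "\<And>r. r > 0 \<Longrightarrow> (p, q) \<in> closure (P r)"
        by auto
      have "p u = q u" for u
      proof (rule ccontr)
        assume ne: "p u \<noteq> q u"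
        define c where "c = \<bar>p u - q u\<bar> / 2"
        have c: "c > 0"
          using ne by (simp add: c_def)
        obtain r where r: "r > 0" "\<And>x y. d x y < r \<Longrightarrow> \<bar>?e x u - ?e y u\<bar> < c"
        proof (cases "u \<in> U_star d")
          case True
          then show ?thesis using c that by (auto simp: U eval_map_def)
        next
          case False
          then show ?thesis using c that[of 1] by (auto simp: eval_map_def)
        qed
        have "closed {z :: cube \<times> cube. \<bar>fst z u - snd z u\<bar> \<le> c}"
          by (intro closed_Collect_le continuous_intros
              continuous_on_product_then_coordinatewise[OF continuous_on_fst[OF continuous_on_id]]
              continuous_on_product_then_coordinatewise[OF continuous_on_snd[OF continuous_on_id]])
        moreover have "P r \<subseteq> {z. \<bar>fst z u - snd z u\<bar> \<le> c}"
          using r(2) by (force simp: P_def)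
        ultimately have "closure (P r) \<subseteq> {z. \<bar>fst z u - snd z u\<bar> \<le> c}"
          by (simp add: closure_minimal)
        with pq(3)[OF r(1)] have "\<bar>p u - q u\<bar> \<le> c"
          by auto
        with c show False by (simp add: c_def)
      qed
      then have "p = q" by auto
      have PS: "P 1 \<subseteq> ?S \<times> ?S"
        using closure_subset by (fastforce simp: P_def)
      have "continuous_on (closure (P 1)) (\<lambda>z. \<bar>g (fst z) - g (snd z)\<bar>)"
      proof (intro continuous_intros continuous_on_compose2[OF g(1)])
        have "closure (P 1) \<subseteq> ?S \<times> ?S"
          by (intro closure_minimal PS closed_Times closed_closure)
        then show "fst ` closure (P 1) \<subseteq> ?S" "snd ` closure (P 1) \<subseteq> ?S"
          by auto
      qed
      then have "e \<le> \<bar>g (fst (p, q)) - g (snd (p, q))\<bar>"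
        by (rule continuous_ge_on_closure) (use pq(3)[of 1] g(2) in \<open>auto simp: P_def\<close>)
      with \<open>p = q\<close> e show False by simp
    qed
    with f show "f \<in> U_star d"
      by (simp add: U)
  qed
  then show "ext_ring (eval_cpt (U_star d)) = U_star d"
    using ext_ring_eval_cpt_superset[OF sub] by blast
qed

lemma smirnov:
  assumes "d \<in> metrics"
  shows "compactification (smirnov d)" "ext_ring (smirnov d) = U_star d"
  using someI[of "\<lambda>K. compactification K \<and> ext_ring K = U_star d", OF smirnov_exists[OF assms]]
  by (simp_all add: smirnov_def)

end

theory Submission
  imports Defs
begin

text \<open>
  Let \<open>\<F>\<close> generate an ultrafilter \<open>\<U>\<close>. To \<open>X \<in> \<F>\<close> assign a metric in which exactly the points of
  \<open>X\<close> cluster, so that the functions constant on \<open>X\<close> are uniformly continuous but those oscillating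
  along \<open>X\<close> are not. Shrinking \<open>X\<close> enlarges the ring of uniformly continuous functions, hence these
  metrics form a directed set. A bounded function has a limit along \<open>\<U>\<close>; altering it on a small
  enough \<open>X \<in> \<F>\<close> to be constantly that limit changes it by at most a given \<open>\<epsilon>\<close>. So the union of the
  rings is uniformly dense in the ring of all bounded functions, and the supremum is \<open>\<beta>\<omega>\<close>.
\<close>

section \<open>Rings of continuously extendable functions\<close>

lemma cpt_le_imp_ext_ring_mono:
  assumes "cpt_le K L"
  shows "ext_ring K \<subseteq> ext_ring L"
proof
  fix f assume "f \<in> ext_ring K"
  then obtain g where f: "f \<in> bounded_funs" and g: "continuous_map (fst K) euclideanreal g" "\<And>n. g (snd K n) = f n"
    by (auto simp: ext_ring_def)
  obtain h where h: "continuous_map (fst L) (fst K) h" "\<And>n. h (snd L n) = snd K n"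
    using assms by (auto simp: cpt_le_def)
  have "continuous_map (fst L) euclideanreal (g \<circ> h)"
    using h(1) g(1) by (rule continuous_map_compose)
  then show "f \<in> ext_ring L"
    using f g(2) h(2) unfolding ext_ring_def by (auto intro!: exI[of _ "g \<circ> h"])
qed

lemma cpt_equiv_imp_cpt_le: "cpt_equiv K L \<Longrightarrow> cpt_le K L"
  unfolding cpt_equiv_def cpt_le_def
  by (metis homeomorphic_imp_continuous_map homeomorphic_imp_surjective_map)

text \<open>Approximants of \<open>f\<close> have continuous extensions that are uniformly Cauchy on
  the dense copy of \<omega>, hence on the whole space; their uniform limit extends
  \<open>f\<close>.\<close>

lemma ext_ring_uniformly_closed:
  fixes K :: "'a cpt"
  assumes K: "compactification K"
    and f: "f \<in> bounded_funs"
    and approx: "\<And>e. e > 0 \<Longrightarrow> \<exists>g\<in>ext_ring K. \<forall>n. \<bar>g n - f n\<bar> \<le> e"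
  shows "f \<in> ext_ring K"
proof -
  let ?X = "fst K"
  define e :: "nat \<Rightarrow> real" where "e k = inverse (Suc k)" for k
  have e0: "e k > 0" for k
    by (simp add: e_def)
  have elim: "e \<longlonglongrightarrow> 0"
    unfolding e_def by (rule LIMSEQ_inverse_real_of_nat)
  have "\<exists>G. continuous_map ?X euclideanreal G \<and> (\<forall>n. \<bar>G (snd K n) - f n\<bar> \<le> e k)" for k
    using approx[OF e0[of k]] by (fastforce simp: ext_ring_def)
  then obtain G where G: "\<And>k. continuous_map ?X euclideanreal (G k)"
    "\<And>k n. \<bar>G k (snd K n) - f n\<bar> \<le> e k"
    by metis
  have dense: "?X closure_of range (snd K) = topspace ?X"
    using K by (simp add: compactification_def)
  have close: "\<bar>G k x - G l x\<bar> \<le> e k + e l" if x: "x \<in> topspace ?X" for k l x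
  proof -
    \<comment> \<open>The estimate defines a closed set; it contains the dense image of \<omega>,
      hence every point.\<close>
    have "closedin ?X {x \<in> topspace ?X. \<bar>G k x - G l x\<bar> \<in> {..e k + e l}}"
      by (rule closedin_continuous_map_preimage[where Y = euclideanreal])
         (auto intro!: continuous_map_real_abs continuous_map_diff G(1))
    moreover have "range (snd K) \<subseteq> {x \<in> topspace ?X. \<bar>G k x - G l x\<bar> \<in> {..e k + e l}}"
    proof clarsimp
      fix n
      show "snd K n \<in> topspace ?X \<and> \<bar>G k (snd K n) - G l (snd K n)\<bar> \<le> e k + e l"
        using compactification_in_topspace[OF K, of n] G(2)[of k n] G(2)[of l n] by linarith
    qed
    ultimately have "?X closure_of range (snd K) \<subseteq> {x \<in> topspace ?X. \<bar>G k x - G l x\<bar> \<in> {..e k + e l}}"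
      by (simp add: closure_of_minimal)
    then show ?thesis
      using x dense by auto
  qed
  have "\<exists>N. \<forall>k l x. N \<le> k \<longrightarrow> N \<le> l \<longrightarrow> x \<in> topspace ?X \<longrightarrow> dist (G k x) (G l x) < r"
    if r: "r > 0" for r
  proof -
    have "\<forall>\<^sub>F k in sequentially. e k < r / 2"
      using order_tendstoD(2)[OF elim, of "r / 2"] r by simp
    then obtain N where N: "\<And>k. k \<ge> N \<Longrightarrow> e k < r / 2"
      by (auto simp: eventually_sequentially)
    have "dist (G k x) (G l x) < r" if "N \<le> k" "N \<le> l" "x \<in> topspace ?X" for k l x
      using N[OF that(1)] N[OF that(2)] close[OF that(3), of k l] by (simp add: dist_real_def)
    then show ?thesis by blast
  qed
  then obtain g where g: "continuous_map ?X Met_TC.mtopology g"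
    "\<And>r. r > 0 \<Longrightarrow> \<forall>\<^sub>F k in sequentially. \<forall>x\<in>topspace ?X. dist (G k x) (g x) < r"
    by (rule Met_TC.continuous_map_uniformly_Cauchy_limit[of ?X G, rotated 2])
       (simp_all add: complete_UNIV G(1))
  have lim: "(\<lambda>k. G k x) \<longlonglongrightarrow> g x" if "x \<in> topspace ?X" for x
    unfolding tendsto_iff using g(2) that by (fast elim: eventually_mono)
  have "continuous_map ?X euclideanreal g"
    using g(1) by simp
  moreover have "g (snd K n) = f n" for n
  proof -
    have "(\<lambda>k. G k (snd K n) - f n) \<longlonglongrightarrow> 0"
      using G(2) by (intro tendsto_rabs_zero_cancel[OF tendsto_sandwich[OF _ _ tendsto_const elim]]) auto
    then have "(\<lambda>k. G k (snd K n)) \<longlonglongrightarrow> f n"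
      by (simp add: LIM_zero_iff)
    then show ?thesis
      using lim[OF compactification_in_topspace[OF K]] LIMSEQ_unique by blast
  qed
  ultimately show ?thesis
    using f by (auto simp: ext_ring_def)
qed

text \<open>The ring determines the compactification: \<open>K\<close> is equivalent to the
  evaluation compactification of its ring, which here is \<open>stone_cech\<close> itself.\<close>

lemma cpt_le_stone_cechI:
  fixes K :: "'a cpt"
  assumes "compactification K" "bounded_funs \<subseteq> ext_ring K"
  shows "cpt_le stone_cech K"
proof -
  have "ext_ring K = bounded_funs"
    using assms(2) by (auto simp: ext_ring_def)
  then show ?thesis
    using cpt_equiv_imp_cpt_le[OF cpt_equiv_eval_cpt[OF assms(1)]] by (simp add: stone_cech_def)
qed

section \<open>Nonprincipal ultrafilters and limits along them\<close>

text \<open>Removing points one at a time stays inside \<open>U\<close>, so exhausting a finite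
  member would put the empty set into \<open>U\<close>.\<close>

lemma nonprincipal_ultrafilter_infinite:
  assumes U: "nonprincipal_ultrafilter U" and X: "X \<in> U"
  shows "infinite X"
proof
  assume "finite X"
  have "X - Y \<in> U" if "finite Y" for Y
    using that
  proof induction
    case (insert n Y)
    have "- {n} \<in> U"
      using U by (auto simp: nonprincipal_ultrafilter_def)
    with insert.IH have "(X - Y) \<inter> - {n} \<in> U"
      using U by (simp add: nonprincipal_ultrafilter_def)
    moreover have "(X - Y) \<inter> - {n} = X - insert n Y"
      by blast
    ultimately show ?case by simp
  qed (simp add: X)
  from this[OF \<open>finite X\<close>] show False
    using U by (simp add: nonprincipal_ultrafilter_def)
qed

lemma bounded_fun_ultrafilter_limit:
  assumes U: "nonprincipal_ultrafilter U" and f: "f \<in> bounded_funs"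
  obtains c where "\<And>e. e > 0 \<Longrightarrow> {n. \<bar>f n - c\<bar> \<le> e} \<in> U"
proof -
  have up: "Y \<in> U" if "X \<in> U" "X \<subseteq> Y" for X Y
    using U that by (auto simp: nonprincipal_ultrafilter_def)
  have int: "X \<inter> Y \<in> U" if "X \<in> U" "Y \<in> U" for X Y
    using U that by (auto simp: nonprincipal_ultrafilter_def)
  have ult: "X \<in> U \<or> - X \<in> U" and emp: "{} \<notin> U" for X
    using U by (auto simp: nonprincipal_ultrafilter_def)
  have UNIV: "UNIV \<in> U"
    using ult[of UNIV] emp by auto
  obtain B where B: "\<And>n. \<bar>f n\<bar> \<le> B"
    using f by (auto simp: bounded_funs_def bounded_iff)
  \<comment> \<open>\<open>T\<close> is the lower cut of the limit, which will be
    \<open>Sup T\<close>.\<close>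
  define T where "T = {t. {n. t \<le> f n} \<in> U}"
  have "- B \<in> T"
  proof -
    have "{n. - B \<le> f n} = UNIV"
      using B by (auto simp: abs_le_iff minus_le_iff)
    with UNIV show ?thesis by (simp add: T_def)
  qed
  have TB: "t \<le> B" if "t \<in> T" for t
  proof -
    have "{n. t \<le> f n} \<noteq> {}"
      using that emp unfolding T_def by (metis mem_Collect_eq)
    then obtain n where "t \<le> f n" by blast
    with B[of n] show ?thesis by linarith
  qed
  then have bdd: "bdd_above T"
    by (auto simp: bdd_above_def)
  show ?thesis
  proof (rule that)
    fix e :: real assume e: "e > 0"
    obtain t where t: "t \<in> T" "Sup T - e < t"
      using less_cSup_iff[of T "Sup T - e"] \<open>- B \<in> T\<close> bdd e by auto
    have "Sup T + e \<notin> T"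
      using cSup_upper[OF _ bdd, of "Sup T + e"] e by auto
    then have "- {n. Sup T + e \<le> f n} \<in> U"
      using ult by (auto simp: T_def)
    with t(1) have "{n. t \<le> f n} \<inter> - {n. Sup T + e \<le> f n} \<in> U"
      by (intro int) (simp_all add: T_def)
    then show "{n. \<bar>f n - Sup T\<bar> \<le> e} \<in> U"
      by (rule up) (use t(2) in \<open>auto simp: abs_le_iff\<close>)
  qed
qed

section \<open>Metrics clustering along a set\<close>

definition cluster_weight :: "nat set \<Rightarrow> nat \<Rightarrow> real" where
  "cluster_weight X n = (if n \<in> X then inverse (Suc n) else 1)"

text \<open>The maximum of positive weights gives an ultrametric. A point outside \<open>X\<close>
  has distance 1 from every other point, while along an infinite \<open>X\<close> distances shrink
  to 0.\<close>

definition cluster_metric :: "nat set \<Rightarrow> nat \<Rightarrow> nat \<Rightarrow> real" where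
  "cluster_metric X m n = (if m = n then 0 else max (cluster_weight X m) (cluster_weight X n))"

lemma cluster_weight_pos: "cluster_weight X n > 0"
  by (simp add: cluster_weight_def)

lemma cluster_weight_antimono: "Y \<subseteq> X \<Longrightarrow> cluster_weight X n \<le> cluster_weight Y n"
  by (auto simp: cluster_weight_def divide_simps)

lemma cluster_metric_antimono: "Y \<subseteq> X \<Longrightarrow> cluster_metric X m n \<le> cluster_metric Y m n"
  using max.mono[OF cluster_weight_antimono cluster_weight_antimono]
  by (auto simp only: cluster_metric_def order_refl split: if_split)

lemma cluster_metric_in_metrics: "cluster_metric X \<in> metrics"
proof -
  interpret Metric_space UNIV "cluster_metric X"
  proof
    fix x y z
    note pos = cluster_weight_pos[of X x] cluster_weight_pos[of X y] cluster_weight_pos[of X z]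
    show "0 \<le> cluster_metric X x y" "cluster_metric X x y = cluster_metric X y x"
      "(cluster_metric X x y = 0) = (x = y)"
      "cluster_metric X x z \<le> cluster_metric X x y + cluster_metric X y z"
      using pos by (auto simp: cluster_metric_def max_def)
  qed
  have "openin mtopology {x}" for x
  proof -
    \<comment> \<open>Every other point is at distance at least the weight of
      \<open>x\<close>.\<close>
    have "mball x (cluster_weight X x) = {x}"
      using cluster_weight_pos[of X x] by (auto simp: cluster_metric_def split: if_splits)
    then show ?thesis
      by (metis openin_mball)
  qed
  then have "mtopology = discrete_topology UNIV"
    by (subst eq_commute) (simp add: discrete_topology_unique)
  with Metric_space_axioms show ?thesis
    by (simp add: metrics_def)
qed

text \<open>Shrinking the set increases distances, so the same radii witness uniform
  continuity.\<close>

lemma metric_le_cluster_metric: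
  assumes "Y \<subseteq> X"
  shows "metric_le (cluster_metric X) (cluster_metric Y)"
  unfolding metric_le_def
proof
  fix f assume "f \<in> U_star (cluster_metric X)"
  then show "f \<in> U_star (cluster_metric Y)"
    using cluster_metric_antimono[OF assms]
    unfolding mem_U_star_iff[OF cluster_metric_in_metrics] by (meson le_less_trans)
qed

text \<open>Distinct points at distance below 1 both lie in \<open>X\<close>, so the radius 1 serves
  every \<open>e\<close>.\<close>

lemma constant_on_imp_U_star_cluster_metric:
  assumes "f \<in> bounded_funs" "\<And>x. x \<in> X \<Longrightarrow> f x = c"
  shows "f \<in> U_star (cluster_metric X)"
proof -
  have "f x = f y" if "cluster_metric X x y < 1" for x y
    using that assms(2) by (auto simp: cluster_metric_def cluster_weight_def split: if_splits)
  then have "\<forall>x y. cluster_metric X x y < 1 \<longrightarrow> \<bar>f x - f y\<bar> < e" if "e > 0" for e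
    using that by simp
  then show ?thesis
    unfolding mem_U_star_iff[OF cluster_metric_in_metrics] using assms(1) zero_less_one by blast
qed

lemma cluster_metric_in_metrics':
  assumes X: "infinite X"
  shows "cluster_metric X \<in> metrics'"
proof -
  note inM = cluster_metric_in_metrics[of X]
  have "\<not> cpt_equiv stone_cech (smirnov (cluster_metric X))"
  proof
    assume "cpt_equiv stone_cech (smirnov (cluster_metric X))"
    then have "ext_ring stone_cech \<subseteq> U_star (cluster_metric X)"
      using cpt_le_imp_ext_ring_mono[OF cpt_equiv_imp_cpt_le] smirnov(2)[OF inM] by blast
    then have all: "bounded_funs \<subseteq> U_star (cluster_metric X)"
      using ext_ring_eval_cpt_superset[of bounded_funs] by (auto simp: stone_cech_def)
    let ?en = "enumerate X"
    \<comment> \<open>\<open>f\<close> alternates between 1 and 0 along the increasing enumeration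
      of \<open>X\<close>, whose consecutive points get arbitrarily close.\<close>
    define f :: "nat \<Rightarrow> real" where "f = indicator (?en ` {n. even n})"
    have "bounded (range f)"
      by (rule bounded_subset[of "{0, 1}"]) (auto simp: f_def indicator_def)
    then have "f \<in> U_star (cluster_metric X)"
      using all by (auto simp: bounded_funs_def)
    then obtain r where r: "r > 0" "\<And>x y. cluster_metric X x y < r \<Longrightarrow> \<bar>f x - f y\<bar> < 1"
      unfolding mem_U_star_iff[OF inM] using zero_less_one by blast
    obtain n where n: "inverse (real (Suc n)) < r"
      using reals_Archimedean[OF r(1)] by blast
    have inj: "?en i = ?en j \<longleftrightarrow> i = j" for i j
      using strict_mono_enumerate[OF X] by (simp add: strict_mono_eq)
    have w: "cluster_weight X (?en m) < r" if "n \<le> m" for m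
    proof -
      have "n \<le> ?en m"
        using le_enumerate[OF X, of m] that by simp
      then have "inverse (real (Suc (?en m))) \<le> inverse (real (Suc n))"
        by (intro le_imp_inverse_le) auto
      also note n
      finally show ?thesis
        using enumerate_in_set[OF X] by (simp add: cluster_weight_def)
    qed
    \<comment> \<open>Doubling \<open>n\<close> fixes the parity and keeps both indices at least
      \<open>n\<close>.\<close>
    have "cluster_metric X (?en (2 * n)) (?en (Suc (2 * n))) < r"
      using w[of "2 * n"] w[of "Suc (2 * n)"] r(1) by (simp add: cluster_metric_def)
    moreover have "f (?en (2 * n)) = 1" "f (?en (Suc (2 * n))) = 0"
      by (auto simp: f_def indicator_def inj)
    ultimately show False
      using r(2) by fastforce
  qed
  with inM show ?thesis
    by (simp add: metrics'_def)
qed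

section \<open>The directed family given by a generating set\<close>

text \<open>The ring of an upper bound \<open>M\<close> contains all rings
  \<open>U_star (cluster_metric Y)\<close> with \<open>Y\<close> in \<open>F\<close>. Being
  uniformly closed, it then contains every bounded function.\<close>

lemma stone_cech_sup_cluster_metrics:
  assumes U: "nonprincipal_ultrafilter U" and F: "generates_ultrafilter F U"
  shows "is_cpt_sup stone_cech (smirnov ` cluster_metric ` F)"
proof -
  have "cpt_le stone_cech M"
    if M: "compactification M" and le: "\<forall>L\<in>smirnov ` cluster_metric ` F. cpt_le L M" for M :: "cube cpt"
  proof (rule cpt_le_stone_cechI[OF M], rule subsetI)
    fix f assume f: "f \<in> bounded_funs"
    obtain c where c: "\<And>e. e > 0 \<Longrightarrow> {n. \<bar>f n - c\<bar> \<le> e} \<in> U"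
      using bounded_fun_ultrafilter_limit[OF U f] by blast
    show "f \<in> ext_ring M"
    proof (rule ext_ring_uniformly_closed[OF M f])
      fix e :: real assume e: "e > 0"
      obtain Y where Y: "Y \<in> F" "Y \<subseteq> {n. \<bar>f n - c\<bar> \<le> e}"
        using F c[OF e] unfolding generates_ultrafilter_def by blast
      \<comment> \<open>Flattening \<open>f\<close> on \<open>Y\<close> to its limit
        \<open>c\<close> moves it by at most \<open>e\<close>.\<close>
      define g where "g n = (if n \<in> Y then c else f n)" for n
      have "bounded (insert c (range f))"
        using f by (simp add: bounded_funs_def)
      then have "bounded (range g)"
        by (rule bounded_subset) (auto simp: g_def)
      then have "g \<in> U_star (cluster_metric Y)"
        by (intro constant_on_imp_U_star_cluster_metric) (auto simp: bounded_funs_def g_def)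
      also have "\<dots> \<subseteq> ext_ring M"
        using cpt_le_imp_ext_ring_mono[of "smirnov (cluster_metric Y)" M] le Y(1)
        by (simp add: smirnov(2)[OF cluster_metric_in_metrics])
      finally have "g \<in> ext_ring M" .
      moreover have "\<bar>g n - f n\<bar> \<le> e" for n
        using Y(2) e by (auto simp: g_def abs_minus_commute)
      ultimately show "\<exists>g\<in>ext_ring M. \<forall>n. \<bar>g n - f n\<bar> \<le> e"
        by blast
    qed
  qed
  then show ?thesis
    unfolding is_cpt_sup_def
    by (auto simp: compactification_stone_cech stone_cech_largest smirnov(1)[OF cluster_metric_in_metrics])
qed

lemma metric_directed_cluster_metrics:
  assumes U: "nonprincipal_ultrafilter U" and F: "generates_ultrafilter F U"
  shows "metric_directed (cluster_metric ` F)"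
  unfolding metric_directed_def
proof clarsimp
  fix X Y assume "X \<in> F" "Y \<in> F"
  then have "X \<in> U" "Y \<in> U"
    using F by (auto simp: generates_ultrafilter_def)
  then have "X \<inter> Y \<in> U"
    using U by (simp add: nonprincipal_ultrafilter_def)
  \<comment> \<open>The intersection lies in \<open>U\<close> but perhaps not in \<open>F\<close>,
    so a generator below it is taken.\<close>
  then obtain Z where "Z \<in> F" "Z \<subseteq> X \<inter> Y"
    using F by (auto simp: generates_ultrafilter_def)
  then show "\<exists>Z\<in>F. metric_le (cluster_metric X) (cluster_metric Z) \<and>
      metric_le (cluster_metric Y) (cluster_metric Z)"
    by (intro bexI[of _ Z] conjI metric_le_cluster_metric) auto
qed

theorem theorem4p1:
  shows "card_inf_le sp' ultrafilter_number"
proof (cases ultrafilter_number)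
  case None
  then show ?thesis by (simp add: card_inf_le_def)
next
  case (Some s)
  then obtain F U where U: "nonprincipal_ultrafilter U" and F: "generates_ultrafilter F U" and s: "s = |F|"
    unfolding ultrafilter_number_def by (blast elim: min_card_SomeE)
  let ?P = "\<lambda>D. D \<subseteq> metrics' \<and> metric_directed D \<and> is_cpt_sup stone_cech (smirnov ` D)"
  have "cluster_metric ` F \<subseteq> metrics'"
    using F nonprincipal_ultrafilter_infinite[OF U]
    by (auto simp: generates_ultrafilter_def intro!: cluster_metric_in_metrics')
  then have P: "?P (cluster_metric ` F)"
    using metric_directed_cluster_metrics[OF U F] stone_cech_sup_cluster_metrics[OF U F] by blast
  \<comment> \<open>This witness rules out the value \<open>None\<close> for \<open>sp'\<close>;
    minimality then bounds \<open>sp'\<close> by the cardinality of the family.\<close>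
  have "\<exists>D. ?P D"
    using P by (rule exI)
  then obtain r where r: "sp' = Some r"
    by (simp only: sp'_def min_card_def if_True)
  then have "r \<le>o |cluster_metric ` F|"
    unfolding sp'_def using P by (elim min_card_SomeE) simp
  also have "|cluster_metric ` F| \<le>o |F|"
    by (rule card_of_image)
  finally show ?thesis
    by (simp add: card_inf_le_def Some r s)
qed

end
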